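(* Let $\Phi_1$ and $\Phi_2$ be any two positive unital linear maps from $\mathbb{M}(n)$ into $\mathbb{M}(k)$. Let $A$ and $B$ be any two Hermitian elements of $\mathbb{M}(n)$. Then $$\left\|\Phi_1(A)-\Phi_2(B)\right\|\le\left\|\mathrm{Eig}^{\downarrow}(A)-\mathrm{Eig}^{\uparrow}(B)\right\|.$$
   Context: $\mathbb{M}(n)$ is the algebra of all $n\times n$ complex matrices. A linear map $\Phi:\mathbb{M}(n)\to\mathbb{M}(k)$ is positive if $\Phi(A)$ is positive semidefinite whenever $A$ is positive semidefinite, and unital if $\Phi(I)=I$. $\|\cdot\|$ denotes the spectral (operator) norm. For a Hermitian matrix $A$, $\mathrm{Eig}^{\downarrow}(A)$ (respectively $\mathrm{Eig}^{\uparrow}(A)$) denotes the diagonal matrix whose diagonal entries are the eigenvalues of $A$, counted with multiplicity, in decreasing (respectively increasing) order. *)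

theory Defs
  imports "Jordan_Normal_Form.Char_Poly" "Jordan_Normal_Form.Schur_Decomposition"
begin

definition hermitian :: "complex mat \<Rightarrow> bool" where
  "hermitian A \<longleftrightarrow> square_mat A \<and> mat_adjoint A = A"

definition pos_semidef :: "complex mat \<Rightarrow> bool" where
  "pos_semidef A \<longleftrightarrow> hermitian A \<and>
     (\<forall>v \<in> carrier_vec (dim_row A). 0 \<le> Re ((A *\<^sub>v v) \<bullet>c v))"

definition linear_mat_map :: "nat \<Rightarrow> nat \<Rightarrow> (complex mat \<Rightarrow> complex mat) \<Rightarrow> bool" where
  "linear_mat_map n k \<Phi> \<longleftrightarrow>
     (\<forall>X \<in> carrier_mat n n. \<Phi> X \<in> carrier_mat k k) \<and>
     (\<forall>X \<in> carrier_mat n n. \<forall>Y \<in> carrier_mat n n. \<Phi> (X + Y) = \<Phi> X + \<Phi> Y) \<and>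
     (\<forall>c. \<forall>X \<in> carrier_mat n n. \<Phi> (c \<cdot>\<^sub>m X) = c \<cdot>\<^sub>m \<Phi> X)"

definition positive_mat_map :: "nat \<Rightarrow> (complex mat \<Rightarrow> complex mat) \<Rightarrow> bool" where
  "positive_mat_map n \<Phi> \<longleftrightarrow>
     (\<forall>X \<in> carrier_mat n n. pos_semidef X \<longrightarrow> pos_semidef (\<Phi> X))"

definition unital_mat_map :: "nat \<Rightarrow> nat \<Rightarrow> (complex mat \<Rightarrow> complex mat) \<Rightarrow> bool" where
  "unital_mat_map n k \<Phi> \<longleftrightarrow> \<Phi> (1\<^sub>m n) = 1\<^sub>m k"

definition vec_norm2 :: "complex vec \<Rightarrow> real" where
  "vec_norm2 v = sqrt (\<Sum>i<dim_vec v. (cmod (v $ i))\<^sup>2)"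

(* The supremum is over the closed unit ball rather than the unit sphere, so that
   it is over a nonempty set also for matrices without columns. *)
definition spectral_norm :: "complex mat \<Rightarrow> real" where
  "spectral_norm A =
     (SUP v \<in> {v \<in> carrier_vec (dim_col A). vec_norm2 v \<le> 1}. vec_norm2 (A *\<^sub>v v))"

(* Roots of the characteristic polynomial, with multiplicity, in increasing order.
   Intended for Hermitian A only: there all roots are real (hermitian_root_real
   below), so that taking real parts loses nothing. *)
definition eigenvalues_incr :: "complex mat \<Rightarrow> real list" where
  "eigenvalues_incr A = sorted_list_of_multiset (image_mset Re (proots (char_poly A)))"

definition Eig_up :: "complex mat \<Rightarrow> complex mat" where
  "Eig_up A = mat_diag (dim_row A) (\<lambda>i. complex_of_real (eigenvalues_incr A ! i))"

definition Eig_down :: "complex mat \<Rightarrow> complex mat" where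
  "Eig_down A = mat_diag (dim_row A) (\<lambda>i. complex_of_real (rev (eigenvalues_incr A) ! i))"

lemma length_eigenvalues_incr:
  assumes "A \<in> carrier_mat n n"
  shows "length (eigenvalues_incr A) = n"
proof -
  have "length (eigenvalues_incr A) = size (mset (eigenvalues_incr A))"
    by (simp only: size_mset)
  also have "\<dots> = size (proots (char_poly A))"
    by (simp add: eigenvalues_incr_def)
  also have "\<dots> = n"
    using degree_monic_char_poly[OF assms] by (simp add: size_proots_complex)
  finally show ?thesis .
qed

lemma hermitian_root_real:
  assumes "hermitian A" and "poly (char_poly A) z = 0"
  shows "Im z = 0"
proof -
  obtain n where A: "A \<in> carrier_mat n n"
    using assms(1) unfolding hermitian_def by (auto intro: carrier_matI)
  have sym: "A $$ (i, j) = cnj (A $$ (j, i))" if "i < n" "j < n" for i j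
  proof -
    have "mat_adjoint A $$ (i, j) = cnj (A $$ (j, i))"
      using that A by (simp add: mat_adjoint_def mat_of_rows_def)
    then show ?thesis using assms(1) by (simp add: hermitian_def)
  qed
  from assms(2) A have "eigenvalue A z"
    by (simp add: eigenvalue_root_char_poly)
  then obtain v where v: "v \<in> carrier_vec n" "v \<noteq> 0\<^sub>v n" "A *\<^sub>v v = z \<cdot>\<^sub>v v"
    using A unfolding eigenvalue_def eigenvector_def by auto
  define s where "s = (\<Sum>i<n. v $ i * cnj (v $ i))"
  have s: "s = of_real (\<Sum>i<n. (cmod (v $ i))\<^sup>2)"
    unfolding s_def by (simp only: complex_norm_square of_real_sum)
  obtain i where i: "i < n" "v $ i \<noteq> 0" using v(1,2) by fastforce
  have "(\<Sum>i<n. (cmod (v $ i))\<^sup>2) > 0"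
    by (rule sum_pos2[of _ i]) (use i in auto)
  then have s0: "s \<noteq> 0" unfolding s by (simp only: of_real_eq_0_iff)
  have row: "(\<Sum>j<n. A $$ (i, j) * v $ j) = z * v $ i" if "i < n" for i
  proof -
    have "(A *\<^sub>v v) $ i = (\<Sum>j<n. A $$ (i, j) * v $ j)"
      using that A v(1) by (simp add: scalar_prod_def atLeast0LessThan)
    then show ?thesis using v that by simp
  qed
  define q where "q = (\<Sum>i<n. \<Sum>j<n. A $$ (i, j) * v $ j * cnj (v $ i))"
  have "q = (\<Sum>i<n. (z * v $ i) * cnj (v $ i))"
    unfolding q_def by (rule sum.cong) (simp_all add: row[symmetric] sum_distrib_right)
  then have q: "q = z * s" unfolding s_def by (simp add: sum_distrib_left mult.assoc)
  have "cnj q = (\<Sum>i<n. \<Sum>j<n. A $$ (j, i) * cnj (v $ j) * v $ i)"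
    unfolding q_def by (simp add: sym[symmetric])
  also have "\<dots> = (\<Sum>j<n. \<Sum>i<n. A $$ (j, i) * cnj (v $ j) * v $ i)"
    by (rule sum.swap)
  also have "\<dots> = q" unfolding q_def by (simp add: mult_ac)
  finally have "cnj z * cnj s = z * s" using q by simp
  moreover have "cnj s = s" unfolding s by simp
  ultimately have "cnj z = z" using s0 by simp
  then show ?thesis by (simp add: complex_eq_iff)
qed

end

theory Submission
  imports Defs "HOL-Analysis.L2_Norm"
begin

text \<open>Only the extreme eigenvalues matter. Positivity and unitality turn
  \<open>\<lambda>\<^sub>m\<^sub>i\<^sub>n I \<le> A \<le> \<lambda>\<^sub>m\<^sub>a\<^sub>x I\<close> into the same bounds for the image of \<open>A\<close>, so the quadratic form of
  \<open>\<Phi>\<^sub>1 A - \<Phi>\<^sub>2 B\<close> lies between \<open>\<lambda>\<^sub>m\<^sub>i\<^sub>n A - \<lambda>\<^sub>m\<^sub>a\<^sub>x B\<close> and \<open>\<lambda>\<^sub>m\<^sub>a\<^sub>x A - \<lambda>\<^sub>m\<^sub>i\<^sub>n B\<close>, which are the last and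
  the first diagonal entry of \<open>Eig_down A - Eig_up B\<close>. For a Hermitian matrix, polarization
  turns a bound on the quadratic form into a bound on the norm.\<close>

section \<open>Real inner product, Euclidean norm and boundedness of matrices\<close>

text \<open>The underlying real inner product of the complex space. \<open>pos_semidef\<close> is
  stated through the same real part, and symmetry together with real bilinearity is what the
  quadratic expansions below rely on.\<close>

definition re_ip :: "complex vec \<Rightarrow> complex vec \<Rightarrow> real" where
  "re_ip x y = Re (x \<bullet>c y)"

lemma re_ip_sum:
  assumes "x \<in> carrier_vec n" "y \<in> carrier_vec n"
  shows "re_ip x y = (\<Sum>i<n. Re (x $ i * cnj (y $ i)))"
  using assms by (simp add: re_ip_def scalar_prod_def atLeast0LessThan)

lemma re_ip_commute:
  assumes "x \<in> carrier_vec n" "y \<in> carrier_vec n"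
  shows "re_ip x y = re_ip y x"
  using assms by (simp add: re_ip_sum[of _ n] mult.commute)

lemma re_ip_add_left:
  assumes "x \<in> carrier_vec n" "y \<in> carrier_vec n" "z \<in> carrier_vec n"
  shows "re_ip (x + y) z = re_ip x z + re_ip y z"
  using assms by (simp add: re_ip_sum[of _ n] algebra_simps sum.distrib)

lemma re_ip_add_right:
  assumes "x \<in> carrier_vec n" "y \<in> carrier_vec n" "z \<in> carrier_vec n"
  shows "re_ip x (y + z) = re_ip x y + re_ip x z"
  using assms by (simp add: re_ip_sum[of _ n] algebra_simps sum.distrib)

lemma re_ip_scale_left:
  assumes "x \<in> carrier_vec n" "y \<in> carrier_vec n"
  shows "re_ip (complex_of_real c \<cdot>\<^sub>v x) y = c * re_ip x y"
  using assms by (simp add: re_ip_sum[of _ n] sum_distrib_left algebra_simps)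

lemma re_ip_scale_right:
  assumes "x \<in> carrier_vec n" "y \<in> carrier_vec n"
  shows "re_ip x (complex_of_real c \<cdot>\<^sub>v y) = c * re_ip x y"
  using assms by (simp add: re_ip_sum[of _ n] sum_distrib_left algebra_simps)

lemmas re_ip_simps = re_ip_add_left re_ip_add_right re_ip_scale_left re_ip_scale_right

lemma vec_norm2_L2_set: "vec_norm2 v = L2_set (\<lambda>i. cmod (v $ i)) {..<dim_vec v}"
  by (simp add: vec_norm2_def L2_set_def)

lemma vec_norm2_nonneg [simp]: "0 \<le> vec_norm2 v"
  by (simp add: vec_norm2_L2_set)

lemma cmod_le_vec_norm2:
  assumes "i < dim_vec v"
  shows "cmod (v $ i) \<le> vec_norm2 v"
  unfolding vec_norm2_L2_set by (rule member_le_L2_set) (use assms in auto)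

lemma re_ip_self: "re_ip v v = (vec_norm2 v)\<^sup>2"
proof -
  have "(vec_norm2 v)\<^sup>2 = (\<Sum>i<dim_vec v. (cmod (v $ i))\<^sup>2)"
    by (simp add: vec_norm2_def sum_nonneg)
  then show ?thesis
    by (simp add: re_ip_sum[of v "dim_vec v" v] cmod_power2 flip: power2_eq_square)
qed

lemma re_ip_le_vec_norm2:
  assumes "x \<in> carrier_vec n" "y \<in> carrier_vec n"
  shows "re_ip x y \<le> vec_norm2 x * vec_norm2 y"
proof -
  have "re_ip x y \<le> (\<Sum>i<n. cmod (x $ i) * cmod (y $ i))"
    unfolding re_ip_sum[OF assms]
    by (rule sum_mono) (metis complex_Re_le_cmod complex_mod_cnj norm_mult)
  also have "\<dots> \<le> vec_norm2 x * vec_norm2 y"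
    using L2_set_mult_ineq[of "\<lambda>i. cmod (x $ i)" "\<lambda>i. cmod (y $ i)" "{..<n}"] assms
    by (simp add: vec_norm2_L2_set)
  finally show ?thesis .
qed

text \<open>The Euclidean norm is at most the sum of the moduli of the coordinates, and each
  coordinate of \<open>v\<close> is at most \<open>vec_norm2 v\<close>. The summand 1 in the
  constant makes it positive even for the zero matrix; later proofs divide by it.\<close>

lemma vec_norm2_mult_mat_vec_bounded:
  assumes "A \<in> carrier_mat m n"
  shows "\<exists>C>0. \<forall>v\<in>carrier_vec n. vec_norm2 (A *\<^sub>v v) \<le> C * vec_norm2 v"
proof (intro exI[of _ "1 + (\<Sum>i<m. \<Sum>j<n. cmod (A $$ (i, j)))"] conjI ballI)
  have "0 \<le> (\<Sum>i<m. \<Sum>j<n. cmod (A $$ (i, j)))"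
    by (intro sum_nonneg norm_ge_zero)
  then show "0 < 1 + (\<Sum>i<m. \<Sum>j<n. cmod (A $$ (i, j)))" by simp
  fix v :: "complex vec" assume v: "v \<in> carrier_vec n"
  have "vec_norm2 (A *\<^sub>v v) \<le> (\<Sum>i<m. cmod ((A *\<^sub>v v) $ i))"
    using assms unfolding vec_norm2_L2_set carrier_matD(1)[OF assms] dim_mult_mat_vec
    by (intro L2_set_le_sum) auto
  also have "\<dots> \<le> (\<Sum>i<m. \<Sum>j<n. cmod (A $$ (i, j)) * vec_norm2 v)"
  proof (rule sum_mono)
    fix i assume "i \<in> {..<m}"
    then have "(A *\<^sub>v v) $ i = (\<Sum>j<n. A $$ (i, j) * v $ j)"
      using assms v by (simp add: scalar_prod_def atLeast0LessThan)
    also have "cmod \<dots> \<le> (\<Sum>j<n. cmod (A $$ (i, j)) * vec_norm2 v)"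
      using v by (intro sum_norm_le) (auto simp: norm_mult intro!: mult_left_mono cmod_le_vec_norm2)
    finally show "cmod ((A *\<^sub>v v) $ i) \<le> (\<Sum>j<n. cmod (A $$ (i, j)) * vec_norm2 v)" .
  qed
  also have "\<dots> \<le> (1 + (\<Sum>i<m. \<Sum>j<n. cmod (A $$ (i, j)))) * vec_norm2 v"
    by (simp add: sum_distrib_right distrib_right)
  finally show "vec_norm2 (A *\<^sub>v v) \<le> (1 + (\<Sum>i<m. \<Sum>j<n. cmod (A $$ (i, j)))) * vec_norm2 v" .
qed

section \<open>Hermitian matrices and their quadratic forms\<close>

lemma hermitian_iff_index:
  assumes "A \<in> carrier_mat n n"
  shows "hermitian A \<longleftrightarrow> (\<forall>i<n. \<forall>j<n. A $$ (i, j) = cnj (A $$ (j, i)))"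
proof -
  have "mat_adjoint A $$ (i, j) = cnj (A $$ (j, i))" if "i < n" "j < n" for i j
    using that assms by (simp add: mat_adjoint_def mat_of_rows_def)
  moreover have "mat_adjoint A \<in> carrier_mat n n"
    using assms by (auto simp: mat_adjoint_def)
  ultimately have "mat_adjoint A = A \<longleftrightarrow> (\<forall>i<n. \<forall>j<n. cnj (A $$ (j, i)) = A $$ (i, j))"
    using assms by (metis carrier_matD eq_matI)
  then show ?thesis
    using assms unfolding hermitian_def by (metis carrier_matD square_mat.simps)
qed

lemma hermitian_add_scale:
  assumes A: "A \<in> carrier_mat n n" "hermitian A" and B: "B \<in> carrier_mat n n" "hermitian B"
  shows "hermitian (complex_of_real a \<cdot>\<^sub>m A + complex_of_real b \<cdot>\<^sub>m B)" (is "hermitian ?X")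
proof -
  have "?X $$ (i, j) = cnj (?X $$ (j, i))" if "i < n" "j < n" for i j
  proof -
    have "A $$ (i, j) = cnj (A $$ (j, i))" "B $$ (i, j) = cnj (B $$ (j, i))"
      using A B that hermitian_iff_index by blast+
    then show ?thesis using that A(1) B(1) by simp
  qed
  then show ?thesis using A(1) B(1) by (subst hermitian_iff_index[of _ n]) auto
qed

lemma hermitian_one: "hermitian (1\<^sub>m n)"
  by (subst hermitian_iff_index[of _ n]) auto

text \<open>Both sides are double sums; after swapping the indices, corresponding terms are complex
  conjugates and so have equal real parts.\<close>

lemma re_ip_hermitian:
  assumes A: "A \<in> carrier_mat n n" "hermitian A"
    and x: "x \<in> carrier_vec n" and y: "y \<in> carrier_vec n"
  shows "re_ip (A *\<^sub>v x) y = re_ip (A *\<^sub>v y) x"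
proof -
  have ip: "re_ip (A *\<^sub>v u) w = (\<Sum>i<n. \<Sum>j<n. Re (A $$ (i, j) * u $ j * cnj (w $ i)))"
    if "u \<in> carrier_vec n" "w \<in> carrier_vec n" for u w
    using that A(1)
    by (simp add: re_ip_sum[of _ n] scalar_prod_def atLeast0LessThan sum_distrib_right del: times_complex.sel)
  have "re_ip (A *\<^sub>v y) x = (\<Sum>j<n. \<Sum>i<n. Re (A $$ (i, j) * y $ j * cnj (x $ i)))"
    unfolding ip[OF y x] by (rule sum.swap)
  also have "\<dots> = re_ip (A *\<^sub>v x) y"
    unfolding ip[OF x y]
  proof (intro sum.cong refl)
    fix i j assume "i \<in> {..<n}" "j \<in> {..<n}"
    then have "A $$ (j, i) = cnj (A $$ (i, j))"
      using A hermitian_iff_index by blast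
    then have "A $$ (j, i) * y $ i * cnj (x $ j) = cnj (A $$ (i, j) * x $ j * cnj (y $ i))"
      by simp
    then show "Re (A $$ (j, i) * y $ i * cnj (x $ j)) = Re (A $$ (i, j) * x $ j * cnj (y $ i))"
      by (simp only: cnj.sel)
  qed
  finally show ?thesis ..
qed

lemma add_scale_mult_vec:
  assumes "A \<in> carrier_mat n n" "B \<in> carrier_mat n n" "v \<in> carrier_vec n"
  shows "(complex_of_real a \<cdot>\<^sub>m A + complex_of_real b \<cdot>\<^sub>m B) *\<^sub>v v
    = complex_of_real a \<cdot>\<^sub>v (A *\<^sub>v v) + complex_of_real b \<cdot>\<^sub>v (B *\<^sub>v v)"
  using assms
  by (subst add_mult_distrib_mat_vec[of _ n n])
     (auto simp: scalar_prod_def sum_distrib_left mult.assoc)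

lemma re_ip_add_scale_mult_vec:
  assumes "A \<in> carrier_mat n n" "B \<in> carrier_mat n n" "v \<in> carrier_vec n" "w \<in> carrier_vec n"
  shows "re_ip ((complex_of_real a \<cdot>\<^sub>m A + complex_of_real b \<cdot>\<^sub>m B) *\<^sub>v v) w
    = a * re_ip (A *\<^sub>v v) w + b * re_ip (B *\<^sub>v v) w"
proof -
  have "A *\<^sub>v v \<in> carrier_vec n" "B *\<^sub>v v \<in> carrier_vec n"
    using assms by auto
  then show ?thesis
    unfolding add_scale_mult_vec[OF assms(1-3)] using assms(4) by (simp add: re_ip_simps[of _ n])
qed

text \<open>The two cross terms agree by \<open>re_ip_hermitian\<close>. This expansion serves
  twice: to minimise over \<open>t\<close> in a semidefinite form, and to polarize.\<close>

lemma re_ip_scaled_sum: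
  assumes A: "A \<in> carrier_mat n n" "hermitian A"
    and v: "v \<in> carrier_vec n" and w: "w \<in> carrier_vec n"
  shows "re_ip (A *\<^sub>v (v + complex_of_real t \<cdot>\<^sub>v w)) (v + complex_of_real t \<cdot>\<^sub>v w)
    = re_ip (A *\<^sub>v v) v + 2 * t * re_ip (A *\<^sub>v v) w + t\<^sup>2 * re_ip (A *\<^sub>v w) w"
proof -
  have Av: "A *\<^sub>v v \<in> carrier_vec n" "A *\<^sub>v w \<in> carrier_vec n"
    using A v w by auto
  have "A *\<^sub>v (v + complex_of_real t \<cdot>\<^sub>v w) = A *\<^sub>v v + complex_of_real t \<cdot>\<^sub>v (A *\<^sub>v w)"
    using A v w by (simp add: mult_add_distrib_mat_vec[of _ n n] mult_mat_vec[of _ n n])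
  then show ?thesis
    using A v w Av re_ip_hermitian[OF A w v]
    by (simp add: re_ip_simps[of _ n] power2_eq_square algebra_simps)
qed

text \<open>The preceding expansion for the identity matrix, whose quadratic form is the squared
  norm.\<close>

lemma vec_norm2_scaled_sum:
  assumes v: "v \<in> carrier_vec n" and w: "w \<in> carrier_vec n"
  shows "(vec_norm2 (v + complex_of_real t \<cdot>\<^sub>v w))\<^sup>2
    = (vec_norm2 v)\<^sup>2 + 2 * t * re_ip v w + t\<^sup>2 * (vec_norm2 w)\<^sup>2"
  using re_ip_scaled_sum[OF one_carrier_mat hermitian_one v w, of t] v w
  by (simp add: re_ip_self)

section \<open>Rayleigh bounds from the real eigenvalues\<close>

text \<open>Evaluate the quadratic form at \<open>v - H v / C\<close>.\<close>

lemma psd_vec_norm2_mult_le: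
  assumes H: "H \<in> carrier_mat n n" "hermitian H"
    and psd: "\<And>v. v \<in> carrier_vec n \<Longrightarrow> 0 \<le> re_ip (H *\<^sub>v v) v"
    and bnd: "\<And>v. v \<in> carrier_vec n \<Longrightarrow> vec_norm2 (H *\<^sub>v v) \<le> C * vec_norm2 v"
    and C: "0 < C" and v: "v \<in> carrier_vec n"
  shows "(vec_norm2 (H *\<^sub>v v))\<^sup>2 \<le> C * re_ip (H *\<^sub>v v) v"
proof -
  define w where "w = H *\<^sub>v v"
  have w: "w \<in> carrier_vec n" using H v unfolding w_def by simp
  have "re_ip (H *\<^sub>v w) w \<le> vec_norm2 (H *\<^sub>v w) * vec_norm2 w"
    using H w by (intro re_ip_le_vec_norm2[of _ n]) auto
  also have "\<dots> \<le> C * vec_norm2 w * vec_norm2 w"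
    by (intro mult_right_mono bnd w vec_norm2_nonneg)
  finally have qw: "re_ip (H *\<^sub>v w) w \<le> C * (vec_norm2 w)\<^sup>2"
    by (simp add: power2_eq_square mult.assoc)
  \<comment> \<open>By the bound just obtained, the form at \<open>v + t w\<close> is at most its
    value at \<open>v\<close> plus \<open>2 t |w|^2 + t^2 C |w|^2\<close>; the choice
    \<open>t = -1/C\<close> minimises this.\<close>
  have "0 \<le> re_ip (H *\<^sub>v v) v + 2 * (-1/C) * re_ip w w + (-1/C)\<^sup>2 * re_ip (H *\<^sub>v w) w"
    using psd[of "v + complex_of_real (-1/C) \<cdot>\<^sub>v w"] v w re_ip_scaled_sum[OF H v w, of "-1/C"]
    unfolding w_def by simp
  also have "\<dots> \<le> re_ip (H *\<^sub>v v) v + 2 * (-1/C) * re_ip w w + (-1/C)\<^sup>2 * (C * (vec_norm2 w)\<^sup>2)"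
    by (intro add_left_mono mult_left_mono qw) simp
  also have "\<dots> = re_ip (H *\<^sub>v v) v - (vec_norm2 w)\<^sup>2 / C"
    using C by (simp add: re_ip_self power2_eq_square field_simps)
  finally show ?thesis
    using C unfolding w_def by (simp add: field_simps)
qed

text \<open>The characteristic matrix has nonzero determinant, hence a left inverse
  \<open>G\<close>. Any norm bound \<open>K\<close> for \<open>G\<close> works, since
  \<open>v\<close> is the image under \<open>G\<close> of the vector on the right.\<close>

lemma non_eigenvalue_bounded_below:
  assumes A: "A \<in> carrier_mat n n" and e: "\<not> eigenvalue A e"
  shows "\<exists>K>0. \<forall>v\<in>carrier_vec n. vec_norm2 v \<le> K * vec_norm2 (char_matrix A e *\<^sub>v v)"
proof -
  let ?H = "char_matrix A e"
  have H: "?H \<in> carrier_mat n n" using A by simp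
  have "det ?H \<noteq> 0" using e eigenvalue_det[OF A] by simp
  from det_non_zero_imp_unit[OF H this, of "()"]
  obtain G where G: "G \<in> carrier_mat n n" "G * ?H = 1\<^sub>m n"
    unfolding Units_def ring_mat_def by auto
  from vec_norm2_mult_mat_vec_bounded[OF G(1)]
  obtain K where K: "K > 0" "\<And>v. v \<in> carrier_vec n \<Longrightarrow> vec_norm2 (G *\<^sub>v v) \<le> K * vec_norm2 v"
    by auto
  have "vec_norm2 v \<le> K * vec_norm2 (?H *\<^sub>v v)" if v: "v \<in> carrier_vec n" for v
  proof -
    have "G *\<^sub>v (?H *\<^sub>v v) = (G * ?H) *\<^sub>v v"
      using G(1) H v by (rule assoc_mult_mat_vec[symmetric])
    also have "\<dots> = v" using G(2) v by simp
    finally show ?thesis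
      using K(2)[of "?H *\<^sub>v v"] H v by simp
  qed
  with K(1) show ?thesis by blast
qed

text \<open>Raise the bound until it is optimal: for the optimal bound, the shifted matrix is positive
  semidefinite but not bounded below, hence singular.\<close>

lemma hermitian_rayleigh_lower:
  assumes A: "A \<in> carrier_mat n n" "hermitian A"
    and l: "\<And>\<mu>. eigenvalue A (complex_of_real \<mu>) \<Longrightarrow> l \<le> \<mu>"
    and v: "v \<in> carrier_vec n"
  shows "l * (vec_norm2 v)\<^sup>2 \<le> re_ip (A *\<^sub>v v) v"
proof (rule ccontr)
  \<comment> \<open>The lower bounds of the Rayleigh quotient. Cauchy-Schwarz puts
    \<open>- C\<close> into \<open>S\<close>, and the vector \<open>v\<close> that violates the
    claim keeps every element of \<open>S\<close> below \<open>l\<close>.\<close>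
  define S where "S = {m. \<forall>v\<in>carrier_vec n. m * (vec_norm2 v)\<^sup>2 \<le> re_ip (A *\<^sub>v v) v}"
  assume neg: "\<not> ?thesis"
  obtain C where C: "C > 0" "\<And>v. v \<in> carrier_vec n \<Longrightarrow> vec_norm2 (A *\<^sub>v v) \<le> C * vec_norm2 v"
    using vec_norm2_mult_mat_vec_bounded[OF A(1)] by auto
  have "- C \<in> S"
    unfolding S_def
  proof (intro CollectI ballI)
    fix u :: "complex vec" assume u: "u \<in> carrier_vec n"
    have Au: "A *\<^sub>v u \<in> carrier_vec n" using A u by simp
    have "- re_ip (A *\<^sub>v u) u = re_ip (complex_of_real (-1) \<cdot>\<^sub>v u) (A *\<^sub>v u)"
      using re_ip_scale_left[OF u Au, of "-1"] re_ip_commute[OF u Au] by simp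
    also have "\<dots> \<le> vec_norm2 (complex_of_real (-1) \<cdot>\<^sub>v u) * vec_norm2 (A *\<^sub>v u)"
      using u Au by (intro re_ip_le_vec_norm2[of _ n]) auto
    also have "\<dots> \<le> vec_norm2 u * (C * vec_norm2 u)"
      using C(2)[OF u] by (intro mult_mono vec_norm2_nonneg) (auto simp: vec_norm2_def)
    finally show "- C * (vec_norm2 u)\<^sup>2 \<le> re_ip (A *\<^sub>v u) u"
      by (simp add: power2_eq_square algebra_simps)
  qed
  have S_less: "m < l" if "m \<in> S" for m
  proof (rule ccontr)
    assume "\<not> m < l"
    then have "l * (vec_norm2 v)\<^sup>2 \<le> m * (vec_norm2 v)\<^sup>2"
      by (intro mult_right_mono) auto
    then show False using that v neg unfolding S_def by fastforce
  qed
  then have bdd: "bdd_above S" by (meson bdd_aboveI less_imp_le)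
  define \<mu> where "\<mu> = Sup S"
  \<comment> \<open>The supremum is attained, because each vector imposes a closed condition on the
    bound. A vector of norm 0 admits no division, but there the condition is the same for every
    bound, so \<open>- C\<close> settles it.\<close>
  have \<mu>_S: "\<mu> \<in> S"
    unfolding S_def
  proof (intro CollectI ballI)
    fix u :: "complex vec" assume u: "u \<in> carrier_vec n"
    show "\<mu> * (vec_norm2 u)\<^sup>2 \<le> re_ip (A *\<^sub>v u) u"
    proof (cases "vec_norm2 u = 0")
      case True
      then show ?thesis using \<open>- C \<in> S\<close> u unfolding S_def by force
    next
      case False
      then have pos: "0 < (vec_norm2 u)\<^sup>2" by simp
      have "\<mu> \<le> re_ip (A *\<^sub>v u) u / (vec_norm2 u)\<^sup>2"
        unfolding \<mu>_def using \<open>- C \<in> S\<close> u pos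
        by (intro cSup_least) (blast, auto simp: S_def pos_le_divide_eq)
      then show ?thesis using pos by (simp add: pos_le_divide_eq)
    qed
  qed
  \<comment> \<open>As an element of \<open>S\<close>, \<open>\<mu>\<close> is less than
    \<open>l\<close>, whereas every real eigenvalue is at least \<open>l\<close>.\<close>
  then have "\<not> eigenvalue A (complex_of_real \<mu>)"
    using l S_less by fastforce
  from non_eigenvalue_bounded_below[OF A(1) this]
  obtain K where K: "K > 0"
    "\<And>u. u \<in> carrier_vec n \<Longrightarrow> vec_norm2 u \<le> K * vec_norm2 (char_matrix A (complex_of_real \<mu>) *\<^sub>v u)"
    by auto
  define H where "H = char_matrix A (complex_of_real \<mu>)"
  have H_eq: "H = complex_of_real 1 \<cdot>\<^sub>m A + complex_of_real (- \<mu>) \<cdot>\<^sub>m 1\<^sub>m n"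
    unfolding H_def char_matrix_def using A by auto
  have H: "H \<in> carrier_mat n n" "hermitian H"
    unfolding H_eq using A(1) by simp (rule hermitian_add_scale[OF A one_carrier_mat hermitian_one])
  have qH: "re_ip (H *\<^sub>v u) u = re_ip (A *\<^sub>v u) u - \<mu> * (vec_norm2 u)\<^sup>2"
    if "u \<in> carrier_vec n" for u
    unfolding H_eq using that A by (subst re_ip_add_scale_mult_vec) (auto simp: re_ip_self)
  obtain D where D: "D > 0" "\<And>v. v \<in> carrier_vec n \<Longrightarrow> vec_norm2 (H *\<^sub>v v) \<le> D * vec_norm2 v"
    using vec_norm2_mult_mat_vec_bounded[OF H(1)] by auto
  \<comment> \<open>The amount by which the bound can be raised: \<open>|u| \<le> K |H u|\<close>
    and \<open>|H u|^2 \<le> D q(u)\<close>, with \<open>q\<close> the form of \<open>H\<close>,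
    give \<open>|u|^2 \<le> K^2 D q(u)\<close>. This contradicts the choice of \<open>\<mu>\<close>
    as supremum.\<close>
  have "\<mu> + 1 / (K\<^sup>2 * D) \<in> S"
    unfolding S_def
  proof (intro CollectI ballI)
    fix u :: "complex vec" assume u: "u \<in> carrier_vec n"
    have "(vec_norm2 u)\<^sup>2 \<le> (K * vec_norm2 (H *\<^sub>v u))\<^sup>2"
      using K(2)[OF u] by (intro power_mono) (auto simp: H_def)
    also have "\<dots> = K\<^sup>2 * (vec_norm2 (H *\<^sub>v u))\<^sup>2" by (simp add: power_mult_distrib)
    also have "\<dots> \<le> K\<^sup>2 * (D * re_ip (H *\<^sub>v u) u)"
      using \<mu>_S qH D u by (intro mult_left_mono psd_vec_norm2_mult_le[OF H]) (auto simp: S_def)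
    finally have "(vec_norm2 u)\<^sup>2 / (K\<^sup>2 * D) \<le> re_ip (H *\<^sub>v u) u"
      using K(1) D(1) by (simp add: field_simps)
    then show "(\<mu> + 1 / (K\<^sup>2 * D)) * (vec_norm2 u)\<^sup>2 \<le> re_ip (A *\<^sub>v u) u"
      using qH[OF u] by (simp add: algebra_simps)
  qed
  then have "\<mu> + 1 / (K\<^sup>2 * D) \<le> \<mu>"
    unfolding \<mu>_def using bdd by (intro cSup_upper)
  moreover have "0 < 1 / (K\<^sup>2 * D)" using K(1) D(1) by simp
  ultimately show False by linarith
qed

text \<open>The lower bound applied to \<open>- A\<close>, whose eigenvalues are the negatives of
  those of \<open>A\<close>.\<close>

lemma hermitian_rayleigh_upper:
  assumes A: "A \<in> carrier_mat n n" "hermitian A"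
    and l: "\<And>\<mu>. eigenvalue A (complex_of_real \<mu>) \<Longrightarrow> \<mu> \<le> l"
    and v: "v \<in> carrier_vec n"
  shows "re_ip (A *\<^sub>v v) v \<le> l * (vec_norm2 v)\<^sup>2"
proof -
  \<comment> \<open>This is \<open>- A\<close>, padded with a zero multiple of the identity so that
    the lemmas on combinations \<open>a A + b B\<close> apply.\<close>
  let ?B = "complex_of_real (-1) \<cdot>\<^sub>m A + complex_of_real 0 \<cdot>\<^sub>m 1\<^sub>m n"
  have B: "?B \<in> carrier_mat n n" "hermitian ?B"
    using A(1) by simp (rule hermitian_add_scale[OF A one_carrier_mat hermitian_one])
  have "- l \<le> \<mu>" if ev: "eigenvalue ?B (complex_of_real \<mu>)" for \<mu>
  proof -
    obtain u where u: "u \<in> carrier_vec n" "u \<noteq> 0\<^sub>v n" "?B *\<^sub>v u = complex_of_real \<mu> \<cdot>\<^sub>v u"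
      using ev B unfolding eigenvalue_def eigenvector_def by auto
    have "?B *\<^sub>v u = - (A *\<^sub>v u)"
      unfolding add_scale_mult_vec[OF A(1) one_carrier_mat u(1)] using A u(1) by auto
    then have "A *\<^sub>v u = - (complex_of_real \<mu> \<cdot>\<^sub>v u)"
      using u(3) by (metis uminus_uminus_vec)
    also have "\<dots> = complex_of_real (- \<mu>) \<cdot>\<^sub>v u" by auto
    finally have "eigenvalue A (complex_of_real (- \<mu>))"
      using u A unfolding eigenvalue_def eigenvector_def by auto
    then show ?thesis using l by fastforce
  qed
  from hermitian_rayleigh_lower[OF B this v]
  have "- l * (vec_norm2 v)\<^sup>2 \<le> re_ip (?B *\<^sub>v v) v" .
  then show ?thesis
    by (subst (asm) re_ip_add_scale_mult_vec[of _ n]) (use A v in auto)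
qed

section \<open>From quadratic forms to the spectral norm\<close>

text \<open>Polarization with \<open>w = H v\<close>: comparing the forms at \<open>v + t w\<close>
  and \<open>v - t w\<close> isolates the mixed term, which is a multiple of \<open>|w|^2\<close>
  because \<open>H v\<close> is paired with itself.\<close>

lemma hermitian_vec_norm2_le:
  assumes H: "H \<in> carrier_mat n n" "hermitian H" and c: "0 \<le> c"
    and bnd: "\<And>v. v \<in> carrier_vec n \<Longrightarrow> \<bar>re_ip (H *\<^sub>v v) v\<bar> \<le> c * (vec_norm2 v)\<^sup>2"
    and v: "v \<in> carrier_vec n"
  shows "vec_norm2 (H *\<^sub>v v) \<le> c * vec_norm2 v"
proof -
  define w where "w = H *\<^sub>v v"
  have w: "w \<in> carrier_vec n" using H v unfolding w_def by simp
  have polar: "2 * t * (vec_norm2 w)\<^sup>2 \<le> c * ((vec_norm2 v)\<^sup>2 + t\<^sup>2 * (vec_norm2 w)\<^sup>2)" for t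
  proof -
    let ?q = "re_ip (H *\<^sub>v v) v + t\<^sup>2 * re_ip (H *\<^sub>v w) w" and ?N = "(vec_norm2 v)\<^sup>2 + t\<^sup>2 * (vec_norm2 w)\<^sup>2"
    have bnd_sum: "\<bar>re_ip (H *\<^sub>v v) v + 2 * s * (vec_norm2 w)\<^sup>2 + s\<^sup>2 * re_ip (H *\<^sub>v w) w\<bar>
        \<le> c * ((vec_norm2 v)\<^sup>2 + 2 * s * re_ip v w + s\<^sup>2 * (vec_norm2 w)\<^sup>2)" for s
      using bnd[of "v + complex_of_real s \<cdot>\<^sub>v w"] v w
      unfolding re_ip_scaled_sum[OF H v w] vec_norm2_scaled_sum[OF v w]
      by (simp add: w_def[symmetric] re_ip_self)
    \<comment> \<open>The upper bound at \<open>t\<close> and the lower bound at \<open>-t\<close>.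
      In their sum both \<open>?q\<close> and the terms with \<open>re_ip v w\<close>
      cancel.\<close>
    have "?q + 2 * t * (vec_norm2 w)\<^sup>2 \<le> c * ?N + c * (2 * t * re_ip v w)"
      using bnd_sum[of t] by (simp add: algebra_simps)
    moreover have "- (?q - 2 * t * (vec_norm2 w)\<^sup>2) \<le> c * ?N - c * (2 * t * re_ip v w)"
      using bnd_sum[of "-t"] by (simp add: algebra_simps)
    ultimately show ?thesis by linarith
  qed
  show ?thesis
  proof (cases "c = 0")
    case True
    then show ?thesis using polar[of 1] by (simp add: w_def)
  next
    case False
    \<comment> \<open>At \<open>t = 1/c\<close> the right-hand side absorbs exactly half of the
      left, leaving \<open>|w|^2 / c \<le> c |v|^2\<close>. This choice is why \<open>c = 0\<close>
      is separate; there \<open>t = 1\<close> already forces \<open>|w| = 0\<close>.\<close>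
    have "2 * (1 / c) * (vec_norm2 w)\<^sup>2 \<le> c * (vec_norm2 v)\<^sup>2 + (vec_norm2 w)\<^sup>2 / c"
      using polar[of "1/c"] False by (simp add: power2_eq_square distrib_left)
    then have "(vec_norm2 w)\<^sup>2 / c \<le> c * (vec_norm2 v)\<^sup>2" by simp
    then have "(vec_norm2 w)\<^sup>2 \<le> c * (vec_norm2 v)\<^sup>2 * c"
      using False c by (subst (asm) pos_divide_le_eq) auto
    also have "\<dots> = (c * vec_norm2 v)\<^sup>2"
      by (simp add: power2_eq_square)
    finally show ?thesis
      unfolding w_def by (rule power2_le_imp_le) (simp add: c)
  qed
qed

lemma spectral_norm_le:
  assumes "A \<in> carrier_mat m n" "0 \<le> c"
    and "\<And>v. v \<in> carrier_vec n \<Longrightarrow> vec_norm2 (A *\<^sub>v v) \<le> c * vec_norm2 v"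
  shows "spectral_norm A \<le> c"
  unfolding spectral_norm_def
proof (rule cSUP_least)
  show "{v \<in> carrier_vec (dim_col A). vec_norm2 v \<le> 1} \<noteq> {}"
    by (auto intro!: exI[of _ "0\<^sub>v (dim_col A)"] simp: vec_norm2_def)
next
  fix v assume "v \<in> {v \<in> carrier_vec (dim_col A). vec_norm2 v \<le> 1}"
  then have "vec_norm2 (A *\<^sub>v v) \<le> c * vec_norm2 v" "vec_norm2 v \<le> 1"
    using assms by auto
  then show "vec_norm2 (A *\<^sub>v v) \<le> c"
    using mult_left_mono[of "vec_norm2 v" 1 c] assms(2) by simp
qed

text \<open>A real supremum dominates its members only once the set is known to be bounded above;
  the entrywise norm bound supplies this.\<close>

lemma vec_norm2_le_spectral_norm:
  assumes A: "A \<in> carrier_mat m n" and v: "v \<in> carrier_vec n" "vec_norm2 v \<le> 1"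
  shows "vec_norm2 (A *\<^sub>v v) \<le> spectral_norm A"
proof -
  obtain C where C: "C > 0" "\<And>v. v \<in> carrier_vec n \<Longrightarrow> vec_norm2 (A *\<^sub>v v) \<le> C * vec_norm2 v"
    using vec_norm2_mult_mat_vec_bounded[OF A] by auto
  have "vec_norm2 (A *\<^sub>v u) \<le> C" if "u \<in> carrier_vec n" "vec_norm2 u \<le> 1" for u
    using C(2)[OF that(1)] mult_left_mono[OF that(2), of C] C(1) by linarith
  then have "bdd_above ((\<lambda>v. vec_norm2 (A *\<^sub>v v)) ` {v \<in> carrier_vec (dim_col A). vec_norm2 v \<le> 1})"
    using A by (auto simp: bdd_above_def)
  then show ?thesis
    unfolding spectral_norm_def using A v by (intro cSUP_upper) auto
qed

lemma spectral_norm_nonneg: "0 \<le> spectral_norm A"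
proof -
  have "vec_norm2 (0\<^sub>v (dim_col A)) \<le> 1" by (simp add: vec_norm2_def)
  then have "vec_norm2 (A *\<^sub>v 0\<^sub>v (dim_col A)) \<le> spectral_norm A"
    by (intro vec_norm2_le_spectral_norm[of _ "dim_row A" "dim_col A"]) auto
  then show ?thesis using vec_norm2_nonneg order_trans by blast
qed

text \<open>The entry is a coordinate of the image of a unit vector. Only this direction is needed
  for \<open>Eig_down A - Eig_up B\<close>: its extreme diagonal entries must be dominated by its
  norm.\<close>

lemma cmod_index_le_spectral_norm:
  assumes A: "A \<in> carrier_mat m n" and ij: "i < m" "j < n"
  shows "cmod (A $$ (i, j)) \<le> spectral_norm A"
proof -
  have "(\<Sum>k<n. (cmod (unit_vec n j $ k))\<^sup>2) = (\<Sum>k<n. if k = j then 1 else 0)"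
    using ij by (intro sum.cong) (auto simp: unit_vec_def)
  then have "vec_norm2 (unit_vec n j) = 1"
    using ij by (simp add: vec_norm2_def)
  then have "vec_norm2 (A *\<^sub>v unit_vec n j) \<le> spectral_norm A"
    using A by (intro vec_norm2_le_spectral_norm) auto
  moreover have "cmod ((A *\<^sub>v unit_vec n j) $ i) \<le> vec_norm2 (A *\<^sub>v unit_vec n j)"
    using A ij by (intro cmod_le_vec_norm2) simp
  moreover have "(A *\<^sub>v unit_vec n j) $ i = A $$ (i, j)"
    using A ij by simp
  ultimately show ?thesis by simp
qed

section \<open>Extreme eigenvalues in the sorted list\<close>

lemma eigenvalue_between_extremes:
  assumes A: "A \<in> carrier_mat n n" and e: "eigenvalue A (complex_of_real \<mu>)"
  shows "eigenvalues_incr A ! 0 \<le> \<mu>" "\<mu> \<le> eigenvalues_incr A ! (n - 1)"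
proof -
  let ?es = "eigenvalues_incr A"
  have "char_poly A \<noteq> 0" using degree_monic_char_poly[OF A] by auto
  then have "complex_of_real \<mu> \<in># proots (char_poly A)"
    using e eigenvalue_root_char_poly[OF A] by simp
  then have "\<mu> \<in># image_mset Re (proots (char_poly A))"
    by force
  then have "\<mu> \<in> set ?es"
    by (simp add: eigenvalues_incr_def)
  \<comment> \<open>The existence of an index below \<open>n\<close> makes \<open>n\<close>
    positive, so \<open>n - 1\<close> really is the last position.\<close>
  then obtain i where i: "i < n" "\<mu> = ?es ! i"
    using length_eigenvalues_incr[OF A] by (auto simp: in_set_conv_nth)
  have "sorted ?es" by (simp add: eigenvalues_incr_def)
  then show "?es ! 0 \<le> \<mu>" "\<mu> \<le> ?es ! (n - 1)"
    unfolding i(2) using i(1) length_eigenvalues_incr[OF A] by (auto intro: sorted_nth_mono)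
qed

section \<open>Positive unital maps preserve the eigenvalue bounds\<close>

lemma linear_unital_map_add_scale:
  assumes lin: "linear_mat_map n k \<Phi>" and unit: "unital_mat_map n k \<Phi>"
    and A: "A \<in> carrier_mat n n"
  shows "\<Phi> (complex_of_real a \<cdot>\<^sub>m A + complex_of_real b \<cdot>\<^sub>m 1\<^sub>m n)
    = complex_of_real a \<cdot>\<^sub>m \<Phi> A + complex_of_real b \<cdot>\<^sub>m 1\<^sub>m k"
  using lin unit A unfolding linear_mat_map_def unital_mat_map_def
  by (metis one_carrier_mat smult_carrier_mat)

text \<open>The hypothesis says that \<open>a A + b I\<close> is positive semidefinite; its image is
  \<open>a \<Phi>(A) + b I\<close>. Taking \<open>a = 1\<close> with minus the smallest eigenvalue,
  and \<open>a = -1\<close> with the largest, yields the two bounds on the image.\<close>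

lemma positive_unital_map_affine:
  assumes lin: "linear_mat_map n k \<Phi>" and pos: "positive_mat_map n \<Phi>"
    and unit: "unital_mat_map n k \<Phi>"
    and A: "A \<in> carrier_mat n n" "hermitian A"
    and bnd: "\<And>v. v \<in> carrier_vec n \<Longrightarrow> 0 \<le> a * re_ip (A *\<^sub>v v) v + b * (vec_norm2 v)\<^sup>2"
  shows "hermitian (complex_of_real a \<cdot>\<^sub>m \<Phi> A + complex_of_real b \<cdot>\<^sub>m 1\<^sub>m k)"
    and "\<And>w. w \<in> carrier_vec k \<Longrightarrow> 0 \<le> a * re_ip (\<Phi> A *\<^sub>v w) w + b * (vec_norm2 w)\<^sup>2"
proof -
  let ?X = "complex_of_real a \<cdot>\<^sub>m A + complex_of_real b \<cdot>\<^sub>m 1\<^sub>m n"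
  have X: "?X \<in> carrier_mat n n" "hermitian ?X"
    using A(1) by simp (rule hermitian_add_scale[OF A one_carrier_mat hermitian_one])
  have \<Phi>A: "\<Phi> A \<in> carrier_mat k k" using lin A unfolding linear_mat_map_def by blast
  have "0 \<le> re_ip (?X *\<^sub>v v) v" if "v \<in> carrier_vec n" for v
    using bnd[OF that] that A by (subst re_ip_add_scale_mult_vec[of _ n]) (auto simp: re_ip_self)
  then have "pos_semidef ?X"
    using X unfolding pos_semidef_def re_ip_def by auto
  then have psd: "pos_semidef (complex_of_real a \<cdot>\<^sub>m \<Phi> A + complex_of_real b \<cdot>\<^sub>m 1\<^sub>m k)"
    using pos X(1) linear_unital_map_add_scale[OF lin unit A(1), of a b]
    unfolding positive_mat_map_def by metis
  then show "hermitian (complex_of_real a \<cdot>\<^sub>m \<Phi> A + complex_of_real b \<cdot>\<^sub>m 1\<^sub>m k)"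
    unfolding pos_semidef_def by blast
  show "0 \<le> a * re_ip (\<Phi> A *\<^sub>v w) w + b * (vec_norm2 w)\<^sup>2" if w: "w \<in> carrier_vec k" for w
  proof -
    have "0 \<le> re_ip ((complex_of_real a \<cdot>\<^sub>m \<Phi> A + complex_of_real b \<cdot>\<^sub>m 1\<^sub>m k) *\<^sub>v w) w"
      using psd \<Phi>A w unfolding pos_semidef_def re_ip_def by auto
    then show ?thesis
      using \<Phi>A w by (subst (asm) re_ip_add_scale_mult_vec[of _ k]) (auto simp: re_ip_self)
  qed
qed

lemma positive_unital_map_hermitian:
  assumes lin: "linear_mat_map n k \<Phi>" and pos: "positive_mat_map n \<Phi>"
    and unit: "unital_mat_map n k \<Phi>"
    and A: "A \<in> carrier_mat n n" "hermitian A"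
  shows "hermitian (\<Phi> A)"
    and "w \<in> carrier_vec k \<Longrightarrow> eigenvalues_incr A ! 0 * (vec_norm2 w)\<^sup>2 \<le> re_ip (\<Phi> A *\<^sub>v w) w"
    and "w \<in> carrier_vec k \<Longrightarrow> re_ip (\<Phi> A *\<^sub>v w) w \<le> eigenvalues_incr A ! (n - 1) * (vec_norm2 w)\<^sup>2"
proof -
  let ?l = "eigenvalues_incr A ! 0" and ?u = "eigenvalues_incr A ! (n - 1)"
  have \<Phi>A: "\<Phi> A \<in> carrier_mat k k" using lin A unfolding linear_mat_map_def by blast
  have lower: "0 \<le> 1 * re_ip (A *\<^sub>v v) v + - ?l * (vec_norm2 v)\<^sup>2" if "v \<in> carrier_vec n" for v
    using hermitian_rayleigh_lower[OF A eigenvalue_between_extremes(1)[OF A(1)] that] by simp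
  have upper: "0 \<le> -1 * re_ip (A *\<^sub>v v) v + ?u * (vec_norm2 v)\<^sup>2" if "v \<in> carrier_vec n" for v
    using hermitian_rayleigh_upper[OF A eigenvalue_between_extremes(2)[OF A(1)] that] by simp
  \<comment> \<open>Positivity speaks only of semidefinite arguments, so \<open>A\<close> is shifted
    by its smallest eigenvalue; the shifted image is Hermitian, and undoing the shift preserves
    this.\<close>
  let ?X = "complex_of_real 1 \<cdot>\<^sub>m \<Phi> A + complex_of_real (- ?l) \<cdot>\<^sub>m 1\<^sub>m k"
  have X: "?X \<in> carrier_mat k k" using \<Phi>A by simp
  have "hermitian ?X"
    by (rule positive_unital_map_affine(1)[OF lin pos unit A lower])
  from hermitian_add_scale[OF X this one_carrier_mat hermitian_one]
  have "hermitian (complex_of_real 1 \<cdot>\<^sub>m ?X + complex_of_real ?l \<cdot>\<^sub>m 1\<^sub>m k)" .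
  also have "complex_of_real 1 \<cdot>\<^sub>m ?X + complex_of_real ?l \<cdot>\<^sub>m 1\<^sub>m k = \<Phi> A"
    using \<Phi>A by auto
  finally show "hermitian (\<Phi> A)" .
  show "?l * (vec_norm2 w)\<^sup>2 \<le> re_ip (\<Phi> A *\<^sub>v w) w" if "w \<in> carrier_vec k"
    using positive_unital_map_affine(2)[OF lin pos unit A lower that] by simp
  show "re_ip (\<Phi> A *\<^sub>v w) w \<le> ?u * (vec_norm2 w)\<^sup>2" if "w \<in> carrier_vec k"
    using positive_unital_map_affine(2)[OF lin pos unit A upper that] by simp
qed

text \<open>A diagonal entry is bounded by the norm. Position \<open>i\<close> of the decreasing
  list is position \<open>n - Suc i\<close> of the increasing one.\<close>

lemma spectral_norm_Eig_diff_ge: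
  assumes A: "A \<in> carrier_mat n n" and B: "B \<in> carrier_mat n n" and i: "i < n"
  shows "\<bar>eigenvalues_incr A ! (n - Suc i) - eigenvalues_incr B ! i\<bar>
    \<le> spectral_norm (Eig_down A - Eig_up B)"
proof -
  have "(Eig_down A - Eig_up B) $$ (i, i)
      = complex_of_real (eigenvalues_incr A ! (n - Suc i) - eigenvalues_incr B ! i)"
    using A B i length_eigenvalues_incr[OF A]
    by (simp add: Eig_down_def Eig_up_def mat_diag_def rev_nth)
  moreover have "Eig_down A - Eig_up B \<in> carrier_mat n n"
    using A B by (auto simp: Eig_down_def Eig_up_def mat_diag_def)
  ultimately show ?thesis
    using cmod_index_le_spectral_norm[of "Eig_down A - Eig_up B" n n i i] i
    by (simp del: of_real_diff)
qed

section \<open>Comparison of the quadratic form with the extreme diagonal entries\<close>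

theorem theorem2p2:
  fixes n k :: nat
    and \<Phi>\<^sub>1 \<Phi>\<^sub>2 :: "complex mat \<Rightarrow> complex mat"
    and A B :: "complex mat"
  assumes "linear_mat_map n k \<Phi>\<^sub>1" and "positive_mat_map n \<Phi>\<^sub>1" and "unital_mat_map n k \<Phi>\<^sub>1"
    and "linear_mat_map n k \<Phi>\<^sub>2" and "positive_mat_map n \<Phi>\<^sub>2" and "unital_mat_map n k \<Phi>\<^sub>2"
    and "A \<in> carrier_mat n n" and "hermitian A"
    and "B \<in> carrier_mat n n" and "hermitian B"
  shows "spectral_norm (\<Phi>\<^sub>1 A - \<Phi>\<^sub>2 B) \<le> spectral_norm (Eig_down A - Eig_up B)"
proof -
  define c where "c = spectral_norm (Eig_down A - Eig_up B)"
  define H where "H = complex_of_real 1 \<cdot>\<^sub>m \<Phi>\<^sub>1 A + complex_of_real (-1) \<cdot>\<^sub>m \<Phi>\<^sub>2 B"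
  note herm1 = positive_unital_map_hermitian[OF assms(1-3) assms(7,8)]
  note herm2 = positive_unital_map_hermitian[OF assms(4-6) assms(9,10)]
  have carr: "\<Phi>\<^sub>1 A \<in> carrier_mat k k" "\<Phi>\<^sub>2 B \<in> carrier_mat k k"
    using assms unfolding linear_mat_map_def by blast+
  then have H: "H \<in> carrier_mat k k" "hermitian H"
    unfolding H_def by simp (rule hermitian_add_scale[OF carr(1) herm1(1) carr(2) herm2(1)])
  have c0: "0 \<le> c" unfolding c_def by (rule spectral_norm_nonneg)
  have "\<bar>re_ip (H *\<^sub>v w) w\<bar> \<le> c * (vec_norm2 w)\<^sup>2" if w: "w \<in> carrier_vec k" for w
  proof (cases "n = 0")
    \<comment> \<open>The eigenvalue lists are empty here, so their entries mean nothing. Instead,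
      the identity of size 0 equals its zero multiple; linearity and unitality transfer this to size
      \<open>k\<close>, which forces \<open>k = 0\<close>.\<close>
    case True
    have zero: "(0::complex) \<cdot>\<^sub>m 1\<^sub>m n = 1\<^sub>m n" using True by auto
    have "(0::complex) \<cdot>\<^sub>m 1\<^sub>m k = 1\<^sub>m k"
      using assms(1,3) zero unfolding linear_mat_map_def unital_mat_map_def
      by (metis one_carrier_mat)
    then have "k = 0"
      by (metis index_one_mat(1) index_one_mat(2) index_smult_mat(1) index_one_mat(3) mult_zero_left neq0_conv zero_neq_one)
    then show ?thesis using w H c0 by (simp add: re_ip_sum[of _ 0])
  next
    case False
    have "re_ip (H *\<^sub>v w) w = re_ip (\<Phi>\<^sub>1 A *\<^sub>v w) w - re_ip (\<Phi>\<^sub>2 B *\<^sub>v w) w"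
      unfolding H_def using carr w by (subst re_ip_add_scale_mult_vec[of _ k]) auto
    \<comment> \<open>Diagonal position 0 pairs the largest eigenvalue of \<open>A\<close> with the
      smallest of \<open>B\<close> and bounds the form from above. Position \<open>n - 1\<close>,
      used next with the opposite sign, pairs the smallest with the largest and bounds it from
      below.\<close>
    moreover have "(eigenvalues_incr A ! (n - 1) - eigenvalues_incr B ! 0) * (vec_norm2 w)\<^sup>2
        \<le> c * (vec_norm2 w)\<^sup>2"
      using spectral_norm_Eig_diff_ge[OF assms(7,9), of 0] False
      unfolding c_def by (intro mult_right_mono) auto
    moreover have "- (eigenvalues_incr A ! 0 - eigenvalues_incr B ! (n - 1)) * (vec_norm2 w)\<^sup>2
        \<le> c * (vec_norm2 w)\<^sup>2"
      using spectral_norm_Eig_diff_ge[OF assms(7,9), of "n - 1"] False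
      unfolding c_def by (intro mult_right_mono) auto
    ultimately show ?thesis
      using herm1(2,3)[OF w] herm2(2,3)[OF w] by (simp add: abs_le_iff algebra_simps)
  qed
  then have "spectral_norm H \<le> c"
    using hermitian_vec_norm2_le[OF H c0] by (intro spectral_norm_le[OF H(1) c0]) blast
  moreover have "H = \<Phi>\<^sub>1 A - \<Phi>\<^sub>2 B"
    unfolding H_def using carr by auto
  ultimately show ?thesis unfolding c_def by simp
qed

end
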